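(* Let $n\ge 1$ and $m\ge 2$ be integers and let $\{H_1,\dots,H_m\}$ be a set of mutually unbiased Bush-type Hadamard matrices of order $4n^2$. Let $N=4n^2(m+1)$ and let $M$ be the $N\times N$ matrix $$M=\begin{bmatrix} I_{4n^2}\\ \frac{1}{2n}H_1\\ \vdots\\ \frac{1}{2n}H_m\end{bmatrix}\begin{bmatrix} I_{4n^2} & \frac{1}{2n}H_1^t & \cdots & \frac{1}{2n}H_m^t\end{bmatrix}.$$ Then $B=2n(M-I_N)$ is a symmetric $(0,1,-1)$-matrix; write $B=B_1-B_2$ with $B_1,B_2$ disjoint $(0,1)$-matrices. Define $$A_0=I_N,\qquad A_1=I_{m+1}\otimes I_{2n}\otimes (J_{2n}-I_{2n}),\qquad A_2=I_{m+1}\otimes (J_{2n}-I_{2n})\otimes J_{2n},$$ $$A_3=(J_{m+1}-I_{m+1})\otimes I_{2n}\otimes J_{2n},\qquad A_4=B_1-A_3,\qquad A_5=B_2.$$ Then $A_0,A_1,A_2,A_3,A_4,A_5$ form a (symmetric) $5$-class association scheme.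
   Context: $I_k$ and $J_k$ denote the identity matrix and the all-ones matrix of order $k$; $\otimes$ is the Kronecker product. Two $(0,1)$-matrices are disjoint if no position is $1$ in both. A Hadamard matrix of order $k$ is a $k\times k$ matrix with entries in $\{-1,1\}$ and pairwise orthogonal rows. Two Hadamard matrices $H,K$ of order $k$ are unbiased if $HK^t=\sqrt{k}\,L$ for some Hadamard matrix $L$; a set of Hadamard matrices is mutually unbiased if any two distinct members are unbiased. A Bush-type Hadamard matrix of order $4n^2$ is a Hadamard matrix $H=[H_{ij}]_{1\le i,j\le 2n}$ of order $4n^2$, partitioned into $2n\times 2n$ blocks $H_{ij}$, such that $H_{ii}=J_{2n}$ for all $i$ and $H_{ij}J_{2n}=J_{2n}H_{ij}=0$ for all $i\neq j$. A symmetric $d$-class association scheme on a vertex set of size $N$ is a set of nonzero symmetric $(0,1)$-matrices $A_0,\dots,A_d$ of order $N$ such that (1) $A_0=I_N$; (2) $\sum_{i=0}^d A_i=J_N$; (3) for all $i,j$, $A_iA_j=\sum_{k=0}^d p_{ij}^kA_k$ for some numbers $p_{ij}^k$. *)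

theory Defs
  imports "Jordan_Normal_Form.Matrix"
begin

definition all_ones :: "nat \<Rightarrow> real mat" where
  "all_ones k = mat k k (\<lambda>_. 1)"

definition kronecker :: "real mat \<Rightarrow> real mat \<Rightarrow> real mat" (infixr "\<otimes>\<^sub>K" 70) where
  "A \<otimes>\<^sub>K B = mat (dim_row A * dim_row B) (dim_col A * dim_col B)
     (\<lambda>(i, j). A $$ (i div dim_row B, j div dim_col B) * B $$ (i mod dim_row B, j mod dim_col B))"

(* The (i,j) block, with i and j counted from 0, of a matrix partitioned into k x k blocks. *)
definition block :: "nat \<Rightarrow> real mat \<Rightarrow> nat \<Rightarrow> nat \<Rightarrow> real mat" where
  "block k A i j = mat k k (\<lambda>(a, b). A $$ (i * k + a, j * k + b))"

(* The b blocks F 0, ..., F (b-1), each of size k x k, placed below (beside) one another. *)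
definition block_column :: "nat \<Rightarrow> nat \<Rightarrow> (nat \<Rightarrow> real mat) \<Rightarrow> real mat" where
  "block_column b k F = mat (b * k) k (\<lambda>(r, c). F (r div k) $$ (r mod k, c))"

definition block_row :: "nat \<Rightarrow> nat \<Rightarrow> (nat \<Rightarrow> real mat) \<Rightarrow> real mat" where
  "block_row b k F = mat k (b * k) (\<lambda>(r, c). F (c div k) $$ (r, c mod k))"

(* The sum of a family of matrices of order N; the type of matrices of all sizes has no zero,
   so the library's sum does not apply to it. *)
definition matrix_sum :: "nat \<Rightarrow> (nat \<Rightarrow> real mat) \<Rightarrow> nat set \<Rightarrow> real mat" where
  "matrix_sum N F I = mat N N (\<lambda>(r, c). \<Sum>i\<in>I. F i $$ (r, c))"

definition zero_one_matrix :: "real mat \<Rightarrow> bool" where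
  "zero_one_matrix A \<longleftrightarrow> elements_mat A \<subseteq> {0, 1}"

definition disjoint_matrices :: "real mat \<Rightarrow> real mat \<Rightarrow> bool" where
  "disjoint_matrices A B \<longleftrightarrow>
     (\<forall>i<dim_row A. \<forall>j<dim_col A. \<not> (A $$ (i, j) = 1 \<and> B $$ (i, j) = 1))"

definition symmetric_matrix :: "real mat \<Rightarrow> bool" where
  "symmetric_matrix A \<longleftrightarrow> transpose_mat A = A"

definition Hadamard :: "nat \<Rightarrow> real mat \<Rightarrow> bool" where
  "Hadamard k H \<longleftrightarrow> H \<in> carrier_mat k k \<and> elements_mat H \<subseteq> {-1, 1} \<and>
     (\<forall>i<k. \<forall>j<k. i \<noteq> j \<longrightarrow> row H i \<bullet> row H j = 0)"

definition unbiased :: "nat \<Rightarrow> real mat \<Rightarrow> real mat \<Rightarrow> bool" where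
  "unbiased k H K \<longleftrightarrow> Hadamard k H \<and> Hadamard k K \<and>
     (\<exists>L. Hadamard k L \<and> H * transpose_mat K = sqrt (real k) \<cdot>\<^sub>m L)"

definition mutually_unbiased :: "nat \<Rightarrow> real mat set \<Rightarrow> bool" where
  "mutually_unbiased k S \<longleftrightarrow> (\<forall>H\<in>S. Hadamard k H) \<and> pairwise (unbiased k) S"

(* Bush-type Hadamard matrices of order 4 n^2. *)
definition Bush_type :: "nat \<Rightarrow> real mat \<Rightarrow> bool" where
  "Bush_type n H \<longleftrightarrow> Hadamard (4 * n\<^sup>2) H \<and>
     (\<forall>i<2 * n. block (2 * n) H i i = all_ones (2 * n)) \<and>
     (\<forall>i<2 * n. \<forall>j<2 * n. i \<noteq> j \<longrightarrow>
        block (2 * n) H i j * all_ones (2 * n) = 0\<^sub>m (2 * n) (2 * n) \<and>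
        all_ones (2 * n) * block (2 * n) H i j = 0\<^sub>m (2 * n) (2 * n))"

(* A 0, ..., A d form a symmetric d-class association scheme on N vertices. Distinctness of the
   A i need not be stated: they are nonzero (0,1)-matrices that sum to the all-ones matrix. *)
definition symmetric_association_scheme :: "nat \<Rightarrow> nat \<Rightarrow> (nat \<Rightarrow> real mat) \<Rightarrow> bool" where
  "symmetric_association_scheme N d A \<longleftrightarrow>
     (\<forall>i\<le>d. A i \<in> carrier_mat N N \<and> A i \<noteq> 0\<^sub>m N N \<and>
        zero_one_matrix (A i) \<and> symmetric_matrix (A i)) \<and>
     A 0 = 1\<^sub>m N \<and>
     matrix_sum N A {..d} = all_ones N \<and>
     (\<exists>p :: nat \<Rightarrow> nat \<Rightarrow> nat \<Rightarrow> real. \<forall>i\<le>d. \<forall>j\<le>d.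
        A i * A j = matrix_sum N (\<lambda>k. p i j k \<cdot>\<^sub>m A k) {..d})"

end

theory Submission
  imports Defs "Jordan_Normal_Form.Determinant"
begin

text \<open>Put \<open>k = 2n\<close> and let \<open>F\<^sub>0 = I\<close>, \<open>F\<^sub>i = H\<^sub>i/k\<close>. The Bush condition says exactly that
  \<open>T = I\<^sub>k \<otimes> J\<^sub>k\<close> is fixed under left multiplication by every \<open>F\<^sub>i\<close> and its transpose. Hence the Gram
  matrix \<open>M\<close> satisfies \<open>M\<^sup>2 = (m+1) M\<close> and \<open>M P = R\<close>, where \<open>P = I \<otimes> I \<otimes> J\<close> and \<open>R = J \<otimes> I \<otimes> J\<close>. Together with
  \<open>Q = I \<otimes> J \<otimes> J\<close> and \<open>U = J \<otimes> J \<otimes> J\<close> this makes the linear span of \<open>I, P, Q, R, U, M\<close> closed under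
  multiplication, and that span is also the span of \<open>A\<^sub>0, \<dots>, A\<^sub>5\<close>. Since a block of \<open>k M\<close> off the
  diagonal is a \<open>\<plusminus>1\<close> matrix fixing \<open>T\<close> up to the factor \<open>k\<close>, its diagonal subblocks are \<open>J\<close> and its other
  subblocks have row sums \<open>0\<close>; this gives the entries of \<open>B\<close> and shows that \<open>A\<^sub>4\<close> and \<open>A\<^sub>5\<close> are nonzero.\<close>

section \<open>Kronecker products\<close>

text \<open>Quotient and remainder identify the indices below \<open>a * b\<close> with pairs. This
  turns the index sum of a Kronecker or block product into a double sum over blocks and positions
  within a block.\<close>

lemma sum_div_mod:
  fixes f :: "nat \<Rightarrow> nat \<Rightarrow> 'a::comm_monoid_add"
  shows "(\<Sum>x<a * b. f (x div b) (x mod b)) = (\<Sum>i<a. \<Sum>j<b. f i j)"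
proof -
  have "(\<Sum>j\<in>{i * b..<i * b + b}. f (j div b) (j mod b)) = (\<Sum>j<b. f i j)" for i
  proof (rule sum.reindex_bij_witness[of _ "\<lambda>j. i * b + j" "\<lambda>j. j - i * b"])
    fix j
    assume j: "j \<in> {i * b..<i * b + b}"
    then have "j div b = i" by (intro div_nat_eqI) (auto simp: mult.commute)
    moreover from this have "j mod b = j - i * b"
      by (simp add: minus_div_mult_eq_mod[symmetric])
    ultimately show "f i (j - i * b) = f (j div b) (j mod b)" by simp
  qed auto
  then show ?thesis
    by (simp add: sum.nat_group[symmetric])
qed

lemma dim_kronecker [simp]:
  "dim_row (A \<otimes>\<^sub>K B) = dim_row A * dim_row B"
  "dim_col (A \<otimes>\<^sub>K B) = dim_col A * dim_col B"
  by (simp_all add: kronecker_def)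

lemma kronecker_carrier [simp]:
  "A \<in> carrier_mat a b \<Longrightarrow> B \<in> carrier_mat c d \<Longrightarrow> A \<otimes>\<^sub>K B \<in> carrier_mat (a * c) (b * d)"
  by (rule carrier_matI) simp_all

lemma index_kronecker:
  assumes "A \<in> carrier_mat a b" "B \<in> carrier_mat c d" "i < a * c" "j < b * d"
  shows "(A \<otimes>\<^sub>K B) $$ (i, j) = A $$ (i div c, j div d) * B $$ (i mod c, j mod d)"
  using assms by (simp add: kronecker_def)

lemma index_times_mat:
  assumes "A \<in> carrier_mat a b" "B \<in> carrier_mat b c" "i < a" "j < c"
  shows "(A * B) $$ (i, j) = (\<Sum>l<b. A $$ (i, l) * B $$ (l, j))"
  using assms by (simp add: scalar_prod_def lessThan_atLeast0)

lemma div_mod_less: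
  fixes i a c :: nat
  assumes "i < a * c"
  shows "i div c < a" "i mod c < c"
proof -
  have "c > 0" using assms by (cases c) auto
  then show "i div c < a" "i mod c < c"
    using assms by (simp_all add: less_mult_imp_div_less)
qed

text \<open>Mixed-product rule. Splitting the inner index \<open>l\<close> into
  \<open>l div d\<close> and \<open>l mod d\<close> makes the summand a product of a term in each
  part, so the double sum factors.\<close>

lemma kronecker_mult:
  assumes A: "A \<in> carrier_mat a b" and B: "B \<in> carrier_mat c d"
    and C: "C \<in> carrier_mat b e" and D: "D \<in> carrier_mat d f"
  shows "(A \<otimes>\<^sub>K B) * (C \<otimes>\<^sub>K D) = (A * C) \<otimes>\<^sub>K (B * D)"
proof (rule eq_matI)
  fix i j
  assume "i < dim_row ((A * C) \<otimes>\<^sub>K (B * D))" "j < dim_col ((A * C) \<otimes>\<^sub>K (B * D))"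
  then have i: "i < a * c" and j: "j < e * f" using A B C D by auto
  note ij = div_mod_less[OF i] div_mod_less[OF j]
  have "((A \<otimes>\<^sub>K B) * (C \<otimes>\<^sub>K D)) $$ (i, j)
      = (\<Sum>l<b * d. (A \<otimes>\<^sub>K B) $$ (i, l) * (C \<otimes>\<^sub>K D) $$ (l, j))"
    using A B C D i j by (intro index_times_mat) auto
  also have "\<dots> = (\<Sum>l<b * d. (A $$ (i div c, l div d) * B $$ (i mod c, l mod d))
      * (C $$ (l div d, j div f) * D $$ (l mod d, j mod f)))"
    using i j by (intro sum.cong) (auto simp: index_kronecker[OF A B] index_kronecker[OF C D])
  also have "\<dots> = (\<Sum>p<b. \<Sum>q<d. (A $$ (i div c, p) * B $$ (i mod c, q))
      * (C $$ (p, j div f) * D $$ (q, j mod f)))"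
    by (rule sum_div_mod)
  also have "\<dots> = (\<Sum>p<b. A $$ (i div c, p) * C $$ (p, j div f))
      * (\<Sum>q<d. B $$ (i mod c, q) * D $$ (q, j mod f))"
    by (simp add: sum_product mult_ac)
  also have "\<dots> = (A * C) $$ (i div c, j div f) * (B * D) $$ (i mod c, j mod f)"
    using index_times_mat[OF A C ij(1,3)] index_times_mat[OF B D ij(2,4)] by simp
  also have "\<dots> = ((A * C) \<otimes>\<^sub>K (B * D)) $$ (i, j)"
    using A B C D i j
    by (intro index_kronecker[of _ a e _ c f, symmetric]) auto
  finally show "((A \<otimes>\<^sub>K B) * (C \<otimes>\<^sub>K D)) $$ (i, j) = ((A * C) \<otimes>\<^sub>K (B * D)) $$ (i, j)" .
qed (use A B C D in auto)

lemma kronecker_smult_left: "(c \<cdot>\<^sub>m A) \<otimes>\<^sub>K B = c \<cdot>\<^sub>m (A \<otimes>\<^sub>K B)"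
  by (rule eq_matI) (auto simp: kronecker_def div_mod_less)

lemma kronecker_smult_right: "A \<otimes>\<^sub>K (c \<cdot>\<^sub>m B) = c \<cdot>\<^sub>m (A \<otimes>\<^sub>K B)"
  by (rule eq_matI) (auto simp: kronecker_def div_mod_less)

lemma transpose_kronecker:
  "transpose_mat (A \<otimes>\<^sub>K B) = transpose_mat A \<otimes>\<^sub>K transpose_mat B"
  by (rule eq_matI) (auto simp: kronecker_def div_mod_less)

lemma elements_mat_subset:
  assumes "A \<in> carrier_mat a b" "\<And>i j. i < a \<Longrightarrow> j < b \<Longrightarrow> A $$ (i, j) \<in> S"
  shows "elements_mat A \<subseteq> S"
  using assms by auto

lemma smult_smult_mat: "a \<cdot>\<^sub>m (b \<cdot>\<^sub>m A) = (a * b) \<cdot>\<^sub>m (A :: real mat)"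
  by (rule eq_matI) auto

lemma one_smult_mat: "1 \<cdot>\<^sub>m A = (A :: real mat)"
  by (rule eq_matI) auto

lemma transpose_smult: "transpose_mat (c \<cdot>\<^sub>m A) = c \<cdot>\<^sub>m transpose_mat (A :: real mat)"
  by (rule eq_matI) auto

lemma all_ones_carrier [simp]: "all_ones k \<in> carrier_mat k k"
  by (simp add: all_ones_def)

lemma index_all_ones [simp]: "i < k \<Longrightarrow> j < k \<Longrightarrow> all_ones k $$ (i, j) = 1"
  by (simp add: all_ones_def)

lemma transpose_all_ones [simp]: "transpose_mat (all_ones k) = all_ones k"
  by (rule eq_matI) (auto simp: all_ones_def)

lemma all_ones_mult: "all_ones k * all_ones k = real k \<cdot>\<^sub>m all_ones k"
  by (rule eq_matI) (auto simp: all_ones_def scalar_prod_def)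

section \<open>Linear spans of matrices\<close>

text \<open>Square matrices of every order share one type, so the span is generated inductively,
  with no fixed order built in. The zero matrix arises as \<open>0\<close> times a
  generator.\<close>

inductive_set mat_lin :: "real mat set \<Rightarrow> real mat set" for S where
  gen: "x \<in> S \<Longrightarrow> x \<in> mat_lin S"
| add: "x \<in> mat_lin S \<Longrightarrow> y \<in> mat_lin S \<Longrightarrow> x + y \<in> mat_lin S"
| smult: "x \<in> mat_lin S \<Longrightarrow> c \<cdot>\<^sub>m x \<in> mat_lin S"

lemma mat_lin_carrier: "x \<in> mat_lin S \<Longrightarrow> S \<subseteq> carrier_mat N N \<Longrightarrow> x \<in> carrier_mat N N"
  by (induction rule: mat_lin.induct) auto

lemma mat_lin_minus:
  assumes "x \<in> mat_lin S" "y \<in> mat_lin S" "S \<subseteq> carrier_mat N N"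
  shows "x - y \<in> mat_lin S"
proof -
  have "x - y = x + (-1) \<cdot>\<^sub>m y"
    using mat_lin_carrier[OF assms(1,3)] mat_lin_carrier[OF assms(2,3)] by auto
  then show ?thesis using assms by (auto intro: mat_lin.intros)
qed

lemma mat_lin_mono:
  assumes "x \<in> mat_lin S" "S \<subseteq> mat_lin T"
  shows "x \<in> mat_lin T"
  using assms by (induction rule: mat_lin.induct) (auto intro: mat_lin.intros)

text \<open>Bilinearity reduces products in the span to products of generators: induction on
  \<open>x\<close> against a fixed generator on the right, then induction on
  \<open>y\<close>.\<close>

lemma mat_lin_mult:
  assumes "x \<in> mat_lin S" "y \<in> mat_lin S" and S: "S \<subseteq> carrier_mat N N"
    and mult: "\<And>s t. s \<in> S \<Longrightarrow> t \<in> S \<Longrightarrow> s * t \<in> mat_lin T"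
  shows "x * y \<in> mat_lin T"
proof -
  have left: "x * t \<in> mat_lin T" if "t \<in> S" for t
    using assms(1)
  proof (induction rule: mat_lin.induct)
    case (add u v)
    have "(u + v) * t = u * t + v * t"
      using mat_lin_carrier[OF add(1) S] mat_lin_carrier[OF add(2) S] S that
      by (intro add_mult_distrib_mat) auto
    then show ?case using add by (auto intro: mat_lin.intros)
  next
    case (smult u c)
    have "(c \<cdot>\<^sub>m u) * t = c \<cdot>\<^sub>m (u * t)"
      using mat_lin_carrier[OF smult(1) S] S that by (intro mult_smult_assoc_mat) auto
    then show ?case using smult by (auto intro: mat_lin.intros)
  qed (use mult that in auto)
  note x = mat_lin_carrier[OF assms(1) S]
  show ?thesis
    using assms(2)
  proof (induction rule: mat_lin.induct)
    case (add u v)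
    have "x * (u + v) = x * u + x * v"
      using mat_lin_carrier[OF add(1) S] mat_lin_carrier[OF add(2) S] x
      by (intro mult_add_distrib_mat) auto
    then show ?case using add by (auto intro: mat_lin.intros)
  next
    case (smult u c)
    have "x * (c \<cdot>\<^sub>m u) = c \<cdot>\<^sub>m (x * u)"
      using mat_lin_carrier[OF smult(1) S] x by (intro mult_smult_distrib) auto
    then show ?case using smult by (auto intro: mat_lin.intros)
  qed (use left in auto)
qed

text \<open>Recovers explicit coefficients from membership in the inductive span; applied to
  \<open>A i * A j\<close> they become the intersection numbers of the scheme.\<close>

lemma mat_lin_coefficients:
  assumes "x \<in> mat_lin (A ` {..d})" and A: "\<And>i. i \<le> d \<Longrightarrow> A i \<in> carrier_mat N N"
  shows "\<exists>c. x = matrix_sum N (\<lambda>k. c k \<cdot>\<^sub>m A k) {..d}"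
  using assms(1)
proof (induction rule: mat_lin.induct)
  case (gen x)
  then obtain i where i: "i \<le> d" "x = A i" by auto
  have "x = matrix_sum N (\<lambda>k. (if k = i then 1 else 0) \<cdot>\<^sub>m A k) {..d}"
  proof (rule eq_matI)
    fix r s
    assume "r < dim_row (matrix_sum N (\<lambda>k. (if k = i then 1 else 0) \<cdot>\<^sub>m A k) {..d})"
      "s < dim_col (matrix_sum N (\<lambda>k. (if k = i then 1 else 0) \<cdot>\<^sub>m A k) {..d})"
    then have rs: "r < N" "s < N" by (auto simp: matrix_sum_def)
    have "(\<Sum>k\<le>d. ((if k = i then 1 else 0) \<cdot>\<^sub>m A k) $$ (r, s))
        = (\<Sum>k\<le>d. if k = i then A k $$ (r, s) else 0)"
      using rs A by (intro sum.cong) (auto simp: carrier_matD[OF A])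
    also have "\<dots> = A i $$ (r, s)" using i by simp
    finally show "x $$ (r, s)
        = matrix_sum N (\<lambda>k. (if k = i then 1 else 0) \<cdot>\<^sub>m A k) {..d} $$ (r, s)"
      using rs i by (simp add: matrix_sum_def)
  qed (use i A[of i] in \<open>auto simp: matrix_sum_def\<close>)
  then show ?case by (intro exI[of _ "\<lambda>k. if k = i then 1 else 0"])
next
  case (add x y)
  then obtain c e where c: "x = matrix_sum N (\<lambda>k. c k \<cdot>\<^sub>m A k) {..d}"
    and e: "y = matrix_sum N (\<lambda>k. e k \<cdot>\<^sub>m A k) {..d}" by auto
  have "x + y = matrix_sum N (\<lambda>k. (c k + e k) \<cdot>\<^sub>m A k) {..d}"
    unfolding c e matrix_sum_def
    by (rule eq_matI)
      (auto simp: sum.distrib[symmetric] distrib_right carrier_matD[OF A] intro!: sum.cong)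
  then show ?case by (intro exI[of _ "\<lambda>k. c k + e k"])
next
  case (smult x a)
  then obtain c where c: "x = matrix_sum N (\<lambda>k. c k \<cdot>\<^sub>m A k) {..d}" by auto
  have "a \<cdot>\<^sub>m x = matrix_sum N (\<lambda>k. (a * c k) \<cdot>\<^sub>m A k) {..d}"
    unfolding c matrix_sum_def
    by (rule eq_matI) (auto simp: sum_distrib_left carrier_matD[OF A] intro!: sum.cong)
  then show ?case by (intro exI[of _ "\<lambda>k. a * c k"])
qed

section \<open>Threefold Kronecker products and multiplication by I \<otimes> J\<close>

lemma kronecker3_carrier [simp]:
  "A \<in> carrier_mat a a \<Longrightarrow> B \<in> carrier_mat b b \<Longrightarrow> C \<in> carrier_mat c c
    \<Longrightarrow> A \<otimes>\<^sub>K B \<otimes>\<^sub>K C \<in> carrier_mat (a * (b * c)) (a * (b * c))"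
  by simp

lemma index_kronecker3:
  assumes "A \<in> carrier_mat a a" "B \<in> carrier_mat b b" "C \<in> carrier_mat c c"
    and "x < a * (b * c)" "y < a * (b * c)"
  shows "(A \<otimes>\<^sub>K B \<otimes>\<^sub>K C) $$ (x, y) = A $$ (x div (b * c), y div (b * c))
    * (B $$ (x mod (b * c) div c, y mod (b * c) div c)
    * C $$ (x mod (b * c) mod c, y mod (b * c) mod c))"
proof -
  have "x mod (b * c) < b * c" "y mod (b * c) < b * c"
    using assms(4,5) by (auto intro: div_mod_less(2))
  then show ?thesis
    using assms
    by (simp add: index_kronecker[of A a a "B \<otimes>\<^sub>K C" "b * c" "b * c"] index_kronecker[of B b b C c c])
qed

lemma kronecker3_mult:
  assumes "A \<in> carrier_mat a a" "B \<in> carrier_mat b b" "C \<in> carrier_mat c c"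
    and "A' \<in> carrier_mat a a" "B' \<in> carrier_mat b b" "C' \<in> carrier_mat c c"
  shows "(A \<otimes>\<^sub>K B \<otimes>\<^sub>K C) * (A' \<otimes>\<^sub>K B' \<otimes>\<^sub>K C') = (A * A') \<otimes>\<^sub>K (B * B') \<otimes>\<^sub>K (C * C')"
  using assms by (simp add: kronecker_mult[of A a a _ "b * c" "b * c" _ a _ "b * c"]
      kronecker_mult[of B b b _ c c _ b _ c])

text \<open>Column \<open>s\<close> of I \<otimes> J is the indicator of the block of
  \<open>k\<close> indices containing \<open>s\<close>, so the product sums a row over that block.
  It serves in both directions: block sums show that Bush-type matrices fix I \<otimes> J up to
  scale, and fixing I \<otimes> J yields the block sums of \<open>M\<close>.\<close>

lemma index_times_block_all_ones:
  assumes A: "A \<in> carrier_mat a (b * k)" and "r < a" "s < b * k"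
  shows "(A * (1\<^sub>m b \<otimes>\<^sub>K all_ones k)) $$ (r, s) = (\<Sum>d<k. A $$ (r, s div k * k + d))"
proof -
  note s = div_mod_less[OF assms(3)]
  have "(A * (1\<^sub>m b \<otimes>\<^sub>K all_ones k)) $$ (r, s)
      = (\<Sum>l<b * k. A $$ (r, l) * (1\<^sub>m b \<otimes>\<^sub>K all_ones k) $$ (l, s))"
    using assms by (intro index_times_mat) auto
  also have "\<dots> = (\<Sum>l<b * k. A $$ (r, l div k * k + l mod k) * (if l div k = s div k then 1 else 0))"
    using assms s by (intro sum.cong) (auto simp: index_kronecker[of _ b b _ k k] div_mod_less)
  also have "\<dots> = (\<Sum>i<b. \<Sum>d<k. A $$ (r, i * k + d) * (if i = s div k then 1 else 0))"
    by (rule sum_div_mod)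
  also have "\<dots> = (\<Sum>i<b. if i = s div k then \<Sum>d<k. A $$ (r, i * k + d) else 0)"
    by (intro sum.cong) auto
  also have "\<dots> = (\<Sum>d<k. A $$ (r, s div k * k + d))"
    using s by simp
  finally show ?thesis .
qed

section \<open>The Gram matrix of a family of block matrices\<close>

lemma block_column_carrier [simp]: "block_column b k F \<in> carrier_mat (b * k) k"
  by (simp add: block_column_def)

lemma block_row_carrier [simp]: "block_row b k F \<in> carrier_mat k (b * k)"
  by (simp add: block_row_def)

lemma index_block_column:
  "r < b * k \<Longrightarrow> c < k \<Longrightarrow> block_column b k F $$ (r, c) = F (r div k) $$ (r mod k, c)"
  by (simp add: block_column_def)

lemma index_block_row:
  "r < k \<Longrightarrow> c < b * k \<Longrightarrow> block_row b k F $$ (r, c) = F (c div k) $$ (r, c mod k)"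
  by (simp add: block_row_def)

lemma index_block_column_times_row:
  assumes F: "\<And>i. i < b \<Longrightarrow> F i \<in> carrier_mat K K" and G: "\<And>i. i < b \<Longrightarrow> G i \<in> carrier_mat K K"
    and x: "x < b * K" and y: "y < b * K"
  shows "(block_column b K F * block_row b K G) $$ (x, y)
    = (F (x div K) * G (y div K)) $$ (x mod K, y mod K)"
proof -
  note x' = div_mod_less[OF x] and y' = div_mod_less[OF y]
  have "(block_column b K F * block_row b K G) $$ (x, y)
      = (\<Sum>l<K. block_column b K F $$ (x, l) * block_row b K G $$ (l, y))"
    using x y by (intro index_times_mat) auto
  also have "\<dots> = (\<Sum>l<K. F (x div K) $$ (x mod K, l) * G (y div K) $$ (l, y mod K))"
    using x y by (simp add: index_block_column index_block_row)
  also have "\<dots> = (F (x div K) * G (y div K)) $$ (x mod K, y mod K)"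
    using x' y' F G by (intro index_times_mat[symmetric, of _ K K _ K]) auto
  finally show ?thesis .
qed

text \<open>The product in the opposite order collapses to a single block, the sum of all
  \<open>F i * G i\<close>. This is what evaluates the square of the Gram matrix.\<close>

lemma index_block_row_times_column:
  assumes F: "\<And>i. i < b \<Longrightarrow> F i \<in> carrier_mat K K" and G: "\<And>i. i < b \<Longrightarrow> G i \<in> carrier_mat K K"
    and r: "r < K" and s: "s < K"
  shows "(block_row b K F * block_column b K G) $$ (r, s) = (\<Sum>i<b. (F i * G i) $$ (r, s))"
proof -
  have "(block_row b K F * block_column b K G) $$ (r, s)
      = (\<Sum>x<b * K. block_row b K F $$ (r, x) * block_column b K G $$ (x, s))"
    using r s by (intro index_times_mat) auto
  also have "\<dots> = (\<Sum>x<b * K. F (x div K) $$ (r, x mod K) * G (x div K) $$ (x mod K, s))"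
    using r s by (simp add: index_block_column index_block_row)
  also have "\<dots> = (\<Sum>i<b. \<Sum>j<K. F i $$ (r, j) * G i $$ (j, s))"
    by (rule sum_div_mod)
  also have "\<dots> = (\<Sum>i<b. (F i * G i) $$ (r, s))"
    using r s by (intro sum.cong refl index_times_mat[symmetric, of _ K K _ K]) (use F G in auto)
  finally show ?thesis .
qed

lemma eq_iff_div_mod:
  "x = y \<longleftrightarrow> x div (b * c) = y div (b * c)
    \<and> x mod (b * c) div c = y mod (b * c) div c \<and> x mod (b * c) mod c = y mod (b * c) mod c"
  for x y b c :: nat
  by (metis div_mult_mod_eq)

text \<open>To be instantiated with \<open>F 0\<close> the identity and the other \<open>F i\<close>
  equal to H_i / k. Then \<open>fix_row\<close> and \<open>fix_col\<close> carry the Bush condition,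
  while \<open>flat\<close> expresses that H_i has entries \<plusminus>1 (when one index is 0) and
  that two of them are unbiased (when both are positive).\<close>

locale unbiased_frames =
  fixes m k :: nat and F :: "nat \<Rightarrow> real mat"
  assumes m_ge: "1 \<le> m" and k_ge: "2 \<le> k"
    and carrier [simp]: "i \<le> m \<Longrightarrow> F i \<in> carrier_mat (k * k) (k * k)"
    and orthogonal: "i \<le> m \<Longrightarrow> F i * transpose_mat (F i) = 1\<^sub>m (k * k)"
    and fix_row: "i \<le> m \<Longrightarrow> F i * (1\<^sub>m k \<otimes>\<^sub>K all_ones k) = 1\<^sub>m k \<otimes>\<^sub>K all_ones k"
    and fix_col: "i \<le> m \<Longrightarrow> transpose_mat (F i) * (1\<^sub>m k \<otimes>\<^sub>K all_ones k) = 1\<^sub>m k \<otimes>\<^sub>K all_ones k"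
    and flat: "i \<le> m \<Longrightarrow> j \<le> m \<Longrightarrow> i \<noteq> j \<Longrightarrow> r < k * k \<Longrightarrow> s < k * k
      \<Longrightarrow> real k * (F i * transpose_mat (F j)) $$ (r, s) \<in> {-1, 1}"
begin

definition "N = (m + 1) * (k * k)"
abbreviation "J \<equiv> all_ones"
text \<open>A vertex is a triple: which of the \<open>m + 1\<close> frames, which subblock of size
  \<open>k\<close>, and which position inside it. These are the coordinates in the three Kronecker
  factors below.\<close>

abbreviation "bl x \<equiv> x div (k * k)"
abbreviation "mid x \<equiv> x mod (k * k) div k"
abbreviation "low x \<equiv> x mod (k * k) mod k"

definition "P = 1\<^sub>m (m + 1) \<otimes>\<^sub>K 1\<^sub>m k \<otimes>\<^sub>K J k"
definition "Q = 1\<^sub>m (m + 1) \<otimes>\<^sub>K J k \<otimes>\<^sub>K J k"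
definition "R = J (m + 1) \<otimes>\<^sub>K 1\<^sub>m k \<otimes>\<^sub>K J k"
definition "U = J (m + 1) \<otimes>\<^sub>K J k \<otimes>\<^sub>K J k"
definition "M = block_column (m + 1) (k * k) F
  * block_row (m + 1) (k * k) (\<lambda>i. transpose_mat (F i))"

lemmas kron_defs = P_def Q_def R_def U_def

lemma carriers [simp]:
  "P \<in> carrier_mat N N" "Q \<in> carrier_mat N N" "R \<in> carrier_mat N N" "U \<in> carrier_mat N N"
  "M \<in> carrier_mat N N"
  unfolding kron_defs M_def N_def
  by (intro kronecker3_carrier mult_carrier_mat[where n = "k * k"] one_carrier_mat all_ones_carrier
      block_column_carrier block_row_carrier)+

lemmas dims [simp] = carriers[THEN carrier_matD(1)] carriers[THEN carrier_matD(2)]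

lemma coordinates_less:
  assumes "x < N"
  shows "bl x < m + 1" "bl x \<le> m" "x mod (k * k) < k * k" "mid x < k" "low x < k"
proof -
  show "bl x < m + 1" and x: "x mod (k * k) < k * k"
    using assms div_mod_less[of x "m + 1" "k * k"] by (auto simp: N_def)
  then show "bl x \<le> m" "mid x < k" "low x < k"
    using div_mod_less[OF x] by auto
qed

lemma kron_mult:
  "P * P = real k \<cdot>\<^sub>m P" "P * Q = real k \<cdot>\<^sub>m Q" "P * R = real k \<cdot>\<^sub>m R" "P * U = real k \<cdot>\<^sub>m U"
  "Q * P = real k \<cdot>\<^sub>m Q" "Q * Q = (real k * real k) \<cdot>\<^sub>m Q" "Q * R = real k \<cdot>\<^sub>m U"
  "Q * U = (real k * real k) \<cdot>\<^sub>m U"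
  "R * P = real k \<cdot>\<^sub>m R" "R * Q = real k \<cdot>\<^sub>m U" "R * R = (real k * real (m + 1)) \<cdot>\<^sub>m R"
  "R * U = (real k * real (m + 1)) \<cdot>\<^sub>m U"
  "U * P = real k \<cdot>\<^sub>m U" "U * Q = (real k * real k) \<cdot>\<^sub>m U" "U * R = (real k * real (m + 1)) \<cdot>\<^sub>m U"
  "U * U = (real k * real k * real (m + 1)) \<cdot>\<^sub>m U"
  unfolding kron_defs
  by (simp_all add: kronecker3_mult[of _ "m + 1" _ k _ k] all_ones_mult kronecker_smult_left
      kronecker_smult_right smult_smult_mat one_smult_mat left_mult_one_mat[OF all_ones_carrier]
      right_mult_one_mat[OF all_ones_carrier])

lemma transposes:
  "transpose_mat P = P" "transpose_mat Q = Q" "transpose_mat R = R" "transpose_mat U = U"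
  unfolding kron_defs by (simp_all add: transpose_kronecker)

lemma M_index:
  assumes "x < N" "y < N"
  shows "M $$ (x, y) = (F (bl x) * transpose_mat (F (bl y))) $$ (x mod (k * k), y mod (k * k))"
  unfolding M_def using assms
  by (intro index_block_column_times_row) (auto simp: N_def)

lemma M_symmetric: "transpose_mat M = M"
proof (rule eq_matI)
  fix x y
  assume "x < dim_row M" "y < dim_col M"
  then have xy: "x < N" "y < N" by auto
  have le: "bl x \<le> m" "bl y \<le> m"
    using coordinates_less[OF xy(1)] coordinates_less[OF xy(2)] by auto
  have "F (bl y) * transpose_mat (F (bl x))
      = transpose_mat (F (bl x) * transpose_mat (F (bl y)))"
    using le by (subst transpose_mult[of _ "k * k" "k * k" _ "k * k"]) auto
  moreover have "F (bl x) * transpose_mat (F (bl y)) \<in> carrier_mat (k * k) (k * k)"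
    using le by (intro mult_carrier_mat[of _ _ "k * k"]) auto
  ultimately show "transpose_mat M $$ (x, y) = M $$ (x, y)"
    using coordinates_less(3)[OF xy(1)] coordinates_less(3)[OF xy(2)]
    by (simp only: index_transpose_mat(1) M_index xy dims carrier_matD)
qed auto

text \<open>Write \<open>M\<close> as \<open>C * D\<close>, a block column times a block row. In the
  other order \<open>D * C\<close> is the sum of \<open>m + 1\<close> identity matrices, so the
  middle factor of \<open>C * (D * C) * D\<close> is scalar.\<close>

lemma M_idempotent: "M * M = real (m + 1) \<cdot>\<^sub>m M"
proof -
  define C where "C = block_column (m + 1) (k * k) F"
  define D where "D = block_row (m + 1) (k * k) (\<lambda>i. transpose_mat (F i))"
  have C: "C \<in> carrier_mat N (k * k)" and D: "D \<in> carrier_mat (k * k) N"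
    unfolding C_def D_def N_def by (rule block_column_carrier block_row_carrier)+
  \<comment> \<open>For square matrices a right inverse is a left inverse, so orthogonal rows give
    orthogonal columns.\<close>
  have orth': "transpose_mat (F i) * F i = 1\<^sub>m (k * k)" if "i \<le> m" for i
    using that by (intro mat_mult_left_right_inverse[OF _ _ orthogonal]) auto
  have DC: "D * C = real (m + 1) \<cdot>\<^sub>m 1\<^sub>m (k * k)"
  proof (rule eq_matI)
    fix r s
    assume "r < dim_row (real (m + 1) \<cdot>\<^sub>m 1\<^sub>m (k * k))" "s < dim_col (real (m + 1) \<cdot>\<^sub>m 1\<^sub>m (k * k))"
    then have rs: "r < k * k" "s < k * k" by auto
    have "(D * C) $$ (r, s) = (\<Sum>i<m + 1. (transpose_mat (F i) * F i) $$ (r, s))"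
      unfolding C_def D_def using rs by (intro index_block_row_times_column) auto
    also have "\<dots> = (\<Sum>i<m + 1. 1\<^sub>m (k * k) $$ (r, s))"
      by (intro sum.cong refl) (simp add: orth')
    finally show "(D * C) $$ (r, s) = (real (m + 1) \<cdot>\<^sub>m 1\<^sub>m (k * k)) $$ (r, s)"
      using rs by simp
  qed (use C D in auto)
  have "M * M = C * (D * C) * D"
    unfolding M_def C_def[symmetric] D_def[symmetric] using C D
    by (simp add: assoc_mult_mat[of _ N "k * k" _ N _ N] assoc_mult_mat[of _ N "k * k" _ "k * k" _ N]
        assoc_mult_mat[of D "k * k" N C "k * k" D N])
  also have "\<dots> = real (m + 1) \<cdot>\<^sub>m (C * D)"
    unfolding DC using C D
    by (simp add: mult_smult_distrib[of C N "k * k" _ "k * k"] mult_smult_assoc_mat[of C N "k * k" D N])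
  finally show ?thesis unfolding M_def C_def D_def .
qed

lemma fix_product:
  assumes "i \<le> m" "j \<le> m"
  shows "F i * transpose_mat (F j) * (1\<^sub>m k \<otimes>\<^sub>K J k) = 1\<^sub>m k \<otimes>\<^sub>K J k"
  using assms
  by (subst assoc_mult_mat[of _ "k * k" "k * k" _ "k * k" _ "k * k"]) (simp_all add: fix_row fix_col)

text \<open>With T = I \<otimes> J, the matrix \<open>P\<close> is block diagonal with blocks T.
  Hence block (i, j) of \<open>M * P\<close> is \<open>F i * transpose_mat (F j)\<close> times T,
  which is T again by \<open>fix_product\<close>; all blocks being T, the product is
  \<open>R\<close>.\<close>

lemma M_P: "M * P = R"
proof (rule eq_matI)
  let ?T = "1\<^sub>m k \<otimes>\<^sub>K J k"
  have T: "?T \<in> carrier_mat (k * k) (k * k)" by simp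
  fix x y
  assume "x < dim_row R" "y < dim_col R"
  then have x: "x < N" and y: "y < N" by auto
  note x' = coordinates_less[OF x] and y' = coordinates_less[OF y]
  let ?G = "\<lambda>i. F (bl x) * transpose_mat (F i)"
  have "(M * P) $$ (x, y) = (\<Sum>z<N. M $$ (x, z) * P $$ (z, y))"
    using x y by (intro index_times_mat) simp_all
  \<comment> \<open>\<open>P\<close> is read as a two-factor product of the identity with T, which
    leaves only the terms \<open>z\<close> in the same block as \<open>y\<close>.\<close>
  also have "\<dots> = (\<Sum>z<N. ?G (bl z) $$ (x mod (k * k), z mod (k * k))
      * ((if bl z = bl y then 1 else 0) * ?T $$ (z mod (k * k), y mod (k * k))))"
  proof (intro sum.cong refl)
    fix z
    assume "z \<in> {..<N}"
    then have z: "z < N" by simp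
    note z' = coordinates_less[OF z]
    show "M $$ (x, z) * P $$ (z, y) = ?G (bl z) $$ (x mod (k * k), z mod (k * k))
      * ((if bl z = bl y then 1 else 0) * ?T $$ (z mod (k * k), y mod (k * k)))"
      unfolding P_def M_index[OF x z] index_kronecker[OF one_carrier_mat T z[unfolded N_def] y[unfolded N_def]]
      using z' y' by simp
  qed
  also have "\<dots> = (\<Sum>i<m + 1. \<Sum>j<k * k. ?G i $$ (x mod (k * k), j)
      * ((if i = bl y then 1 else 0) * ?T $$ (j, y mod (k * k))))"
    unfolding N_def by (rule sum_div_mod)
  also have "\<dots> = (\<Sum>i<m + 1. if i = bl y then \<Sum>j<k * k. ?G i $$ (x mod (k * k), j)
      * ?T $$ (j, y mod (k * k)) else 0)"
    by (intro sum.cong) auto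
  also have "\<dots> = (\<Sum>j<k * k. ?G (bl y) $$ (x mod (k * k), j) * ?T $$ (j, y mod (k * k)))"
    using y' by simp
  also have "\<dots> = (?G (bl y) * ?T) $$ (x mod (k * k), y mod (k * k))"
    using x' y' T
    by (intro index_times_mat[symmetric, of _ "k * k" _ _ "k * k"] mult_carrier_mat[of _ _ "k * k"]) auto
  also have "\<dots> = R $$ (x, y)"
    unfolding R_def index_kronecker[OF all_ones_carrier T x[unfolded N_def] y[unfolded N_def]]
    using x' y' by (simp add: fix_product)
  finally show "(M * P) $$ (x, y) = R $$ (x, y)" .
qed simp_all

text \<open>Since \<open>X\<close> absorbs \<open>P\<close> up to the factor \<open>k\<close>, one
  may insert \<open>P\<close> between \<open>M\<close> and \<open>X\<close> and use
  \<open>M_P\<close>. All products of \<open>M\<close> with \<open>Q\<close>, \<open>R\<close> and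
  \<open>U\<close> thus reduce to Kronecker products.\<close>

lemma M_mult_left:
  assumes X: "X \<in> carrier_mat N N" "P * X = real k \<cdot>\<^sub>m X"
  shows "M * X = (1 / real k) \<cdot>\<^sub>m (R * X)"
proof -
  have "R * X = M * (P * X)"
    using X by (simp add: M_P[symmetric] assoc_mult_mat[of _ N N _ N _ N])
  also have "\<dots> = real k \<cdot>\<^sub>m (M * X)"
    using X by (simp add: mult_smult_distrib[of _ N N _ N])
  finally show ?thesis
    using k_ge by (simp add: smult_smult_mat one_smult_mat)
qed

lemma M_mult:
  "M * Q = U" "M * R = real (m + 1) \<cdot>\<^sub>m R" "M * U = real (m + 1) \<cdot>\<^sub>m U"
  using k_ge by (simp_all add: M_mult_left kron_mult smult_smult_mat one_smult_mat)

text \<open>Transposes of the products with \<open>M\<close> on the left, all factors being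
  symmetric.\<close>

lemma mult_M:
  "P * M = R" "Q * M = U" "R * M = real (m + 1) \<cdot>\<^sub>m R" "U * M = real (m + 1) \<cdot>\<^sub>m U"
proof -
  have swap: "X * M = transpose_mat (M * X)" if "X \<in> carrier_mat N N" "transpose_mat X = X" for X
    using that by (simp add: transpose_mult[of M N N X N] M_symmetric)
  show "P * M = R" "Q * M = U" "R * M = real (m + 1) \<cdot>\<^sub>m R" "U * M = real (m + 1) \<cdot>\<^sub>m U"
    by (simp_all add: swap transposes M_P M_mult transpose_smult)
qed

section \<open>Closure of the span under multiplication\<close>

definition "basis = {1\<^sub>m N, P, Q, R, U, M}"

lemma basis_carrier: "basis \<subseteq> carrier_mat N N"
  unfolding basis_def by simp

text \<open>Apart from the identity, the multiplication table has 25 entries, and each is a scalar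
  multiple of a single generator.\<close>

lemma basis_mult:
  assumes "s \<in> basis" "t \<in> basis"
  shows "s * t \<in> mat_lin basis"
proof -
  have gens: "X \<in> mat_lin basis" if "X \<in> basis" for X
    using that by (rule mat_lin.gen)
  show ?thesis
  proof (cases "s = 1\<^sub>m N \<or> t = 1\<^sub>m N")
    case True
    moreover have "s \<in> carrier_mat N N" "t \<in> carrier_mat N N"
      using assms basis_carrier by auto
    ultimately have "s * t = t \<or> s * t = s"
      by auto
    then show ?thesis using assms gens by auto
  next
    case False
    have "s \<in> {P, Q, R, U, M}" "t \<in> {P, Q, R, U, M}"
      using False assms by (auto simp: basis_def)
    moreover have "P \<in> mat_lin basis" "Q \<in> mat_lin basis" "R \<in> mat_lin basis"
      "U \<in> mat_lin basis" "M \<in> mat_lin basis"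
      by (rule gens; simp add: basis_def)+
    ultimately show ?thesis
      by (elim insertE emptyE)
        (simp_all only: kron_mult M_mult mult_M M_P M_idempotent mat_lin.smult)
  qed
qed

section \<open>Entries of the generators and of the Gram matrix\<close>

lemma index_block_identity:
  assumes "r < k * k" "s < k * k"
  shows "(1\<^sub>m k \<otimes>\<^sub>K J k) $$ (r, s) = of_bool (r div k = s div k)"
  using assms div_mod_less[OF assms(1)] div_mod_less[OF assms(2)]
  by (simp add: index_kronecker[of _ k k _ k k])

lemma index_kron:
  assumes "x < N" "y < N"
  shows "P $$ (x, y) = of_bool (bl x = bl y \<and> mid x = mid y)"
    "Q $$ (x, y) = of_bool (bl x = bl y)"
    "R $$ (x, y) = of_bool (mid x = mid y)"
    "U $$ (x, y) = 1"
  using coordinates_less[OF assms(1)] coordinates_less[OF assms(2)]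
  unfolding kron_defs
    index_kronecker3[OF one_carrier_mat one_carrier_mat all_ones_carrier assms[unfolded N_def]]
    index_kronecker3[OF one_carrier_mat all_ones_carrier all_ones_carrier assms[unfolded N_def]]
    index_kronecker3[OF all_ones_carrier one_carrier_mat all_ones_carrier assms[unfolded N_def]]
    index_kronecker3[OF all_ones_carrier all_ones_carrier all_ones_carrier assms[unfolded N_def]]
  by simp_all

lemma M_diagonal_block:
  assumes "x < N" "y < N" "bl x = bl y"
  shows "M $$ (x, y) = of_bool (x = y)"
proof -
  have "x = y \<longleftrightarrow> x mod (k * k) = y mod (k * k)"
    using assms(3) by (metis div_mult_mod_eq)
  then show ?thesis
    using assms coordinates_less[OF assms(1)] coordinates_less(3)[OF assms(1)] coordinates_less(3)[OF assms(2)]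
    by (simp add: M_index orthogonal del: mod_less_divisor)
qed

lemma M_flat:
  assumes "x < N" "y < N" "bl x \<noteq> bl y"
  shows "real k * M $$ (x, y) \<in> {-1, 1}"
  unfolding M_index[OF assms(1,2)]
  using coordinates_less[OF assms(1)] coordinates_less[OF assms(2)] assms(3) by (intro flat)

text \<open>This is \<open>fix_product\<close> read entrywise: multiplying by I \<otimes> J sums a
  row over a subblock, and the result is an entry of I \<otimes> J.\<close>

lemma block_row_sum:
  assumes "i \<le> m" "j \<le> m" "r < k * k" "s < k * k"
  shows "(\<Sum>d<k. real k * (F i * transpose_mat (F j)) $$ (r, s div k * k + d))
    = real k * of_bool (r div k = s div k)"
proof -
  have "F i * transpose_mat (F j) \<in> carrier_mat (k * k) (k * k)"
    using assms by (intro mult_carrier_mat[of _ _ "k * k"]) auto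
  from index_times_block_all_ones[OF this assms(3,4)] show ?thesis
    using assms by (simp add: fix_product index_block_identity sum_distrib_left)
qed

text \<open>The \<open>k\<close> entries of a row of a diagonal subblock are at most \<open>1\<close> (after scaling by \<open>k\<close>)
  and add up to \<open>k\<close>, hence they are all \<open>1\<close>.\<close>
lemma M_mid:
  assumes x: "x < N" and y: "y < N" and "bl x \<noteq> bl y" "mid x = mid y"
  shows "real k * M $$ (x, y) = 1"
proof -
  note x' = coordinates_less[OF x] and y' = coordinates_less[OF y]
  let ?G = "F (bl x) * transpose_mat (F (bl y))"
  define g where "g d = real k * ?G $$ (x mod (k * k), mid y * k + d)" for d
  have g: "g d \<le> 1" if "d < k" for d
  proof -
    have "mid y * k + d < Suc (mid y) * k" using that by simp
    also have "\<dots> \<le> k * k" using y'(4) by (intro mult_right_mono) auto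
    finally have "g d \<in> {-1, 1}"
      unfolding g_def using x' y' assms(3) by (intro flat)
    then show ?thesis by auto
  qed
  have "(\<Sum>d<k. g d) = real k"
    unfolding g_def using block_row_sum[OF x'(2) y'(2) x'(3) y'(3)] assms(4) by simp
  then have "(\<Sum>d<k. 1 - g d) = 0"
    by (simp add: sum_subtractf)
  then have "1 - g (low y) = 0"
    using g y'(5) by (subst (asm) sum_nonneg_eq_0_iff) auto
  then show ?thesis
    unfolding M_index[OF x y] g_def by simp
qed

text \<open>A row of a subblock off the diagonal consists of \<plusminus>1 entries (after scaling by
  \<open>k\<close>) with sum 0, so it cannot be constant and both signs occur. The two signs later
  show that \<open>A 4\<close> and \<open>A 5\<close> are nonzero.\<close>

lemma M_signs:
  assumes e: "e \<in> {-1, 1 :: real}"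
  shows "\<exists>x<N. \<exists>y<N. bl x \<noteq> bl y \<and> mid x \<noteq> mid y \<and> real k * M $$ (x, y) = e"
proof -
  \<comment> \<open>The first row of subblock (0, 1) of the block for frames 0 and 1; it exists
    because \<open>k\<close> is at least 2 and \<open>m\<close> at least 1.\<close>
  define g where "g d = real k * (F 0 * transpose_mat (F 1)) $$ (0, k + d)" for d
  have kk: "k + d < k * k" if "d < k" for d
  proof -
    have "k + d < 2 * k" using that by simp
    also have "\<dots> \<le> k * k" using k_ge by (intro mult_right_mono) auto
    finally show ?thesis .
  qed
  have sum0: "(\<Sum>d<k. g d) = 0"
    unfolding g_def using block_row_sum[of 0 1 0 k] kk[of 0] k_ge m_ge by simp
  have "\<exists>d<k. g d = e"
  proof (rule ccontr)
    assume none: "\<not> (\<exists>d<k. g d = e)"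
    have "g d = - e" if "d < k" for d
    proof -
      have "g d \<in> {-1, 1}"
        unfolding g_def using kk[OF that] k_ge m_ge by (intro flat) auto
      then show ?thesis using none that e by auto
    qed
    then have "(\<Sum>d<k. g d) = - real k * e" by simp
    then show False using sum0 e k_ge by auto
  qed
  then obtain d where d: "d < k" "g d = e" by blast
  \<comment> \<open>The vertex with block 1, subblock 1 and position \<open>d\<close>, to be paired
    with vertex 0.\<close>
  define y where "y = k * k + (k + d)"
  have y: "y < N" "0 < N"
  proof -
    have "y < 2 * (k * k)" using kk[OF d(1)] by (simp add: y_def)
    also have "\<dots> \<le> N" unfolding N_def using m_ge by (intro mult_right_mono) auto
    finally show "y < N" "0 < N" by auto
  qed
  have bly: "bl y = 1" and ymod: "y mod (k * k) = k + d"
    using kk[OF d(1)] k_ge by (simp_all add: y_def)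
  have "mid y = 1" using d(1) k_ge by (simp add: ymod)
  moreover have "real k * M $$ (0, y) = e"
    using d(2) by (simp add: M_index[OF y(2,1)] bly ymod g_def)
  ultimately show ?thesis using y bly by (intro exI[of _ 0] exI[of _ y] conjI) auto
qed

section \<open>The matrix B, its signs and its splitting\<close>

definition "B = real k \<cdot>\<^sub>m (M - 1\<^sub>m N)"
definition "A1 = 1\<^sub>m (m + 1) \<otimes>\<^sub>K 1\<^sub>m k \<otimes>\<^sub>K (J k - 1\<^sub>m k)"
definition "A2 = 1\<^sub>m (m + 1) \<otimes>\<^sub>K (J k - 1\<^sub>m k) \<otimes>\<^sub>K J k"
definition "A3 = (J (m + 1) - 1\<^sub>m (m + 1)) \<otimes>\<^sub>K 1\<^sub>m k \<otimes>\<^sub>K J k"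

abbreviation pos where "pos x y \<equiv> real k * M $$ (x, y) = 1"

lemma B_carrier: "B \<in> carrier_mat N N"
  unfolding B_def by (intro smult_carrier_mat minus_carrier_mat one_carrier_mat)

lemma A_carrier: "A1 \<in> carrier_mat N N" "A2 \<in> carrier_mat N N" "A3 \<in> carrier_mat N N"
  unfolding A1_def A2_def A3_def N_def
  by (intro kronecker3_carrier one_carrier_mat all_ones_carrier minus_carrier_mat)+

lemma index_A:
  assumes "x < N" "y < N"
  shows "A1 $$ (x, y) = of_bool (bl x = bl y \<and> mid x = mid y \<and> x \<noteq> y)"
    "A2 $$ (x, y) = of_bool (bl x = bl y \<and> mid x \<noteq> mid y)"
    "A3 $$ (x, y) = of_bool (bl x \<noteq> bl y \<and> mid x = mid y)"
proof -
  note less = coordinates_less[OF assms(1)] coordinates_less[OF assms(2)]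
  note C = one_carrier_mat all_ones_carrier minus_carrier_mat
  show "A1 $$ (x, y) = of_bool (bl x = bl y \<and> mid x = mid y \<and> x \<noteq> y)"
    unfolding A1_def index_kronecker3[OF C(1) C(1) C(3)[OF C(1)] assms[unfolded N_def]]
      eq_iff_div_mod[of x y k k] using less by (simp add: all_ones_def)
  show "A2 $$ (x, y) = of_bool (bl x = bl y \<and> mid x \<noteq> mid y)"
    unfolding A2_def index_kronecker3[OF C(1) C(3)[OF C(1)] C(2) assms[unfolded N_def]]
    using less by (simp add: all_ones_def)
  show "A3 $$ (x, y) = of_bool (bl x \<noteq> bl y \<and> mid x = mid y)"
    unfolding A3_def index_kronecker3[OF C(3)[OF C(1)] C(1) C(2) assms[unfolded N_def]]
    using less by (simp add: all_ones_def)
qed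

text \<open>On a diagonal block \<open>M\<close> is the identity and cancels. Elsewhere
  \<open>flat\<close> leaves only \<plusminus>1, and \<open>M_mid\<close> forces the value 1 when
  the subblocks agree.\<close>

lemma index_B:
  assumes "x < N" "y < N"
  shows "B $$ (x, y) = (if bl x = bl y then 0 else if mid x = mid y \<or> pos x y then 1 else -1)"
proof -
  have "B $$ (x, y) = real k * (M $$ (x, y) - of_bool (x = y))"
    using assms by (simp add: B_def)
  then show ?thesis
    using M_diagonal_block[OF assms] M_flat[OF assms] M_mid[OF assms]
    by (cases "x = y") auto
qed

lemma pos_sym:
  assumes "x < N" "y < N"
  shows "pos y x = pos x y"
proof -
  have "M $$ (y, x) = transpose_mat M $$ (x, y)" using assms by simp
  then show ?thesis by (simp only: M_symmetric)
qed

lemma symmetric_B: "symmetric_matrix B"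
  unfolding symmetric_matrix_def
  by (rule eq_matI) (use B_carrier in \<open>auto simp: index_B pos_sym\<close>)

lemma elements_B: "elements_mat B \<subseteq> {0, 1, -1}"
  using B_carrier by (rule elements_mat_subset) (simp add: index_B)

lemma B_split_exists:
  "\<exists>B1 B2. B1 \<in> carrier_mat N N \<and> B2 \<in> carrier_mat N N \<and>
    zero_one_matrix B1 \<and> zero_one_matrix B2 \<and> disjoint_matrices B1 B2 \<and> B = B1 - B2"
proof (intro exI conjI)
  let ?B1 = "mat N N (\<lambda>(x, y). of_bool (B $$ (x, y) = 1)) :: real mat"
  let ?B2 = "mat N N (\<lambda>(x, y). of_bool (B $$ (x, y) = -1)) :: real mat"
  show "?B1 \<in> carrier_mat N N" "?B2 \<in> carrier_mat N N" by auto
  show "zero_one_matrix ?B1" "zero_one_matrix ?B2" "disjoint_matrices ?B1 ?B2"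
    by (auto simp: zero_one_matrix_def disjoint_matrices_def elements_mat_subset[of _ N N])
  show "B = ?B1 - ?B2"
    by (rule eq_matI) (use B_carrier in \<open>auto simp: index_B\<close>)
qed

end

section \<open>The association scheme\<close>

lemma all_le_5: "(\<forall>i\<le>5. p i) \<longleftrightarrow> p 0 \<and> p 1 \<and> p 2 \<and> p 3 \<and> p 4 \<and> p (5::nat)"
proof -
  have "i \<le> 5 \<longleftrightarrow> i = 0 \<or> i = 1 \<or> i = 2 \<or> i = 3 \<or> i = 4 \<or> i = 5" for i :: nat
    by arith
  then show ?thesis
    by (simp only: imp_disjL all_conj_distrib simp_thms)
qed

context unbiased_frames
begin

context
  fixes B1 B2 :: "real mat"
  assumes B1: "B1 \<in> carrier_mat N N" "zero_one_matrix B1"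
    and B2: "B2 \<in> carrier_mat N N" "zero_one_matrix B2"
    and disjoint: "disjoint_matrices B1 B2" and split: "B = B1 - B2"
begin

abbreviation "A i \<equiv> [1\<^sub>m N, A1, A2, A3, B1 - A3, B2] ! i"

lemma A_list: "A 0 = 1\<^sub>m N" "A 1 = A1" "A 2 = A2" "A 3 = A3" "A 4 = B1 - A3" "A 5 = B2"
  by (simp_all add: numeral_eq_Suc)

text \<open>Disjoint (0,1)-matrices are determined by their difference: an entry 1, 0 or -1 of
  \<open>B\<close> forces the pair (1,0), (0,0) or (0,1). Every admissible splitting is therefore
  the one into positive and negative parts.\<close>

lemma index_split:
  assumes "x < N" "y < N"
  shows "B1 $$ (x, y) = of_bool (bl x \<noteq> bl y \<and> (mid x = mid y \<or> pos x y))"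
    and "B2 $$ (x, y) = of_bool (bl x \<noteq> bl y \<and> mid x \<noteq> mid y \<and> \<not> pos x y)"
proof -
  have "B1 $$ (x, y) \<in> {0, 1}" "B2 $$ (x, y) \<in> {0, 1}"
    using B1 B2 assms elements_matI unfolding zero_one_matrix_def by blast+
  moreover have "\<not> (B1 $$ (x, y) = 1 \<and> B2 $$ (x, y) = 1)"
    using disjoint B1(1) assms by (auto simp: disjoint_matrices_def)
  moreover have "B $$ (x, y) = B1 $$ (x, y) - B2 $$ (x, y)"
    unfolding split using B1(1) B2(1) assms by simp
  ultimately show "B1 $$ (x, y) = of_bool (bl x \<noteq> bl y \<and> (mid x = mid y \<or> pos x y))"
    "B2 $$ (x, y) = of_bool (bl x \<noteq> bl y \<and> mid x \<noteq> mid y \<and> \<not> pos x y)"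
    by (auto simp: index_B[OF assms] split: if_splits)
qed

lemma A_carriers: "i \<le> 5 \<Longrightarrow> A i \<in> carrier_mat N N"
proof -
  have "\<forall>i\<le>5. A i \<in> carrier_mat N N"
    unfolding all_le_5 A_list using A_carrier B1(1) B2(1) by auto
  then show "i \<le> 5 \<Longrightarrow> A i \<in> carrier_mat N N" by blast
qed

lemma A_dims:
  "dim_row A1 = N" "dim_col A1 = N" "dim_row A2 = N" "dim_col A2 = N"
  "dim_row A3 = N" "dim_col A3 = N" "dim_row B1 = N" "dim_col B1 = N"
  "dim_row B2 = N" "dim_col B2 = N" "dim_row B = N" "dim_col B = N"
  using A_carrier B1(1) B2(1) B_carrier by auto

text \<open>The support of \<open>A3\<close> lies inside that of \<open>B1\<close>, because
  \<open>B\<close> is 1 wherever the blocks differ and the subblocks agree; so the difference is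
  again a (0,1)-matrix.\<close>

lemma index_A4:
  assumes "x < N" "y < N"
  shows "(B1 - A3) $$ (x, y) = of_bool (bl x \<noteq> bl y \<and> mid x \<noteq> mid y \<and> pos x y)"
  using assms by (auto simp: A_dims index_A index_split)

lemma A_zero_one: "i \<le> 5 \<Longrightarrow> zero_one_matrix (A i)"
proof -
  have "\<forall>i\<le>5. zero_one_matrix (A i)"
    unfolding all_le_5 A_list zero_one_matrix_def
    by (intro conjI elements_mat_subset[of _ N N])
      (use A_carrier B1(1) B2(1) in \<open>auto simp: A_dims index_A index_split\<close>)
  then show "i \<le> 5 \<Longrightarrow> zero_one_matrix (A i)" by blast
qed

lemma A_symmetric: "i \<le> 5 \<Longrightarrow> symmetric_matrix (A i)"
proof -
  have "symmetric_matrix X" if "X \<in> carrier_mat N N"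
    "\<And>x y. x < N \<Longrightarrow> y < N \<Longrightarrow> X $$ (y, x) = X $$ (x, y)" for X
    unfolding symmetric_matrix_def using that by (intro eq_matI) auto
  note symI = this
  have "\<forall>i\<le>5. symmetric_matrix (A i)"
    unfolding all_le_5 A_list
  proof (intro conjI)
    show "symmetric_matrix (1\<^sub>m N)" by (rule symI) auto
    show "symmetric_matrix A1" "symmetric_matrix A2" "symmetric_matrix A3"
      by (rule symI; use A_carrier in \<open>auto simp: index_A\<close>)+
    show "symmetric_matrix (B1 - A3)"
      by (rule symI) (use A_carrier B1(1) in \<open>auto simp: A_dims index_A index_split pos_sym\<close>)
    show "symmetric_matrix B2"
      by (rule symI) (use B2(1) in \<open>auto simp: index_split pos_sym\<close>)
  qed
  then show "i \<le> 5 \<Longrightarrow> symmetric_matrix (A i)" by blast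
qed

text \<open>The vertices \<open>1\<close>, \<open>k\<close> and \<open>k * k\<close> differ from
  vertex \<open>0\<close> in exactly one coordinate, namely \<open>low\<close>, \<open>mid\<close>
  and \<open>bl\<close>; they witness \<open>A1\<close>, \<open>A2\<close> and \<open>A3\<close>.
  The last two matrices use \<open>M_signs\<close>.\<close>

lemma A_nonzero: "i \<le> 5 \<Longrightarrow> A i \<noteq> 0\<^sub>m N N"
proof -
  have nz: "X \<noteq> 0\<^sub>m N N" if "x < N" "y < N" "X $$ (x, y) = 1" for X :: "real mat" and x y
    using that by auto
  have kk: "k < k * k" "1 < k" using k_ge by auto
  have N: "2 * (k * k) \<le> N"
    unfolding N_def using m_ge by (intro mult_right_mono) auto
  then have less: "0 < N" "1 < N" "k < N" "k * k < N" using kk by linarith+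
  obtain x y where xy: "x < N" "y < N" "bl x \<noteq> bl y" "mid x \<noteq> mid y" "pos x y"
    using M_signs[of 1] by auto
  obtain u v where uv: "u < N" "v < N" "bl u \<noteq> bl v" "mid u \<noteq> mid v" "real k * M $$ (u, v) = -1"
    using M_signs[of "-1"] by auto
  have "\<forall>i\<le>5. A i \<noteq> 0\<^sub>m N N"
    unfolding all_le_5 A_list
  proof (intro conjI)
    show "1\<^sub>m N \<noteq> (0\<^sub>m N N :: real mat)" using less by (intro nz[of 0 0]) auto
    show "A1 \<noteq> 0\<^sub>m N N" using index_A(1)[OF less(1,2)] kk by (intro nz[OF less(1,2)]) simp
    show "A2 \<noteq> 0\<^sub>m N N" using index_A(2)[OF less(1,3)] kk by (intro nz[OF less(1,3)]) simp
    show "A3 \<noteq> 0\<^sub>m N N" using index_A(3)[OF less(1,4)] kk by (intro nz[OF less(1,4)]) simp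
    show "B1 - A3 \<noteq> 0\<^sub>m N N" using index_A4[OF xy(1,2)] xy(3-5)
      by (intro nz[OF xy(1,2)]) (simp only: of_bool_eq simp_thms)
    show "B2 \<noteq> 0\<^sub>m N N" using uv by (intro nz[of u v]) (auto simp: index_split)
  qed
  then show "i \<le> 5 \<Longrightarrow> A i \<noteq> 0\<^sub>m N N" by blast
qed

lemma A_sum: "matrix_sum N A {..5} = J N"
proof (rule eq_matI)
  fix x y
  assume "x < dim_row (J N)" "y < dim_col (J N)"
  then have xy: "x < N" "y < N" by (auto simp: all_ones_def)
  have "(\<Sum>i\<le>5. A i $$ (x, y)) = A 0 $$ (x, y) + A 1 $$ (x, y) + A 2 $$ (x, y) + A 3 $$ (x, y)
      + A 4 $$ (x, y) + A 5 $$ (x, y)"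
    by (simp add: numeral_eq_Suc)
  also have "\<dots> = 1"
    unfolding A_list using xy by (auto simp: A_dims index_A index_split)
  finally show "matrix_sum N A {..5} $$ (x, y) = J N $$ (x, y)"
    using xy by (simp add: matrix_sum_def)
qed (simp_all add: matrix_sum_def all_ones_def)

lemma A_in_basis_span: "i \<le> 5 \<Longrightarrow> A i \<in> mat_lin basis"
proof -
  have gens: "1\<^sub>m N \<in> mat_lin basis" "P \<in> mat_lin basis" "Q \<in> mat_lin basis" "R \<in> mat_lin basis"
    "U \<in> mat_lin basis" "M \<in> mat_lin basis"
    by (rule mat_lin.gen; simp add: basis_def)+
  note minus = mat_lin_minus[OF _ _ basis_carrier]
  have B: "B \<in> mat_lin basis"
    unfolding B_def by (intro mat_lin.smult minus gens)
  have A1: "A1 = P - 1\<^sub>m N" and A2: "A2 = Q - P" and A3: "A3 = R - P"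
    by (rule eq_matI; auto simp: A_dims index_A index_kron)+
  \<comment> \<open>\<open>U - Q\<close> is 1 exactly off the diagonal blocks, so it is the
    entrywise absolute value of \<open>B\<close>. Half of \<open>(U - Q) - B\<close> is then the
    negative part of \<open>B\<close>, and half of \<open>(U - Q) + B\<close> the positive
    part.\<close>
  have A5: "B2 = (1 / 2) \<cdot>\<^sub>m ((U - Q) - B)"
    by (rule eq_matI) (auto simp: A_dims index_split index_kron index_B)
  have A4: "B1 - A3 = ((1 / 2) \<cdot>\<^sub>m ((U - Q) + B)) - A3"
    by (rule eq_matI) (auto simp: A_dims index_split index_A index_kron index_B)
  have "A3 \<in> mat_lin basis" unfolding A3 by (intro minus gens)
  then have "\<forall>i\<le>5. A i \<in> mat_lin basis"
    unfolding all_le_5 A_list unfolding A4 unfolding A1 A2 A5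
    by (intro conjI mat_lin.smult mat_lin.add minus gens B)
  then show "i \<le> 5 \<Longrightarrow> A i \<in> mat_lin basis" by blast
qed

text \<open>Inverts the change of generators in \<open>A_in_basis_span\<close>: each generator is
  rebuilt from the earlier ones and the \<open>A i\<close>, with \<open>M\<close> recovered from
  \<open>B\<close>.\<close>

lemma basis_in_A_span: "basis \<subseteq> mat_lin (A ` {..5})"
proof -
  \<comment> \<open>Naming this difference keeps \<open>closed\<close> from splitting it, since
    \<open>B1\<close> by itself is not among the matrices known to lie in the span.\<close>
  define D where "D = B1 - A3"
  define V where "V = mat_lin (A ` {..5})"
  have "\<forall>i\<le>5. A i \<in> V"
    unfolding V_def by (auto intro: mat_lin.gen)
  note gens = this[unfolded all_le_5 A_list, folded D_def]
  have "A ` {..5} \<subseteq> carrier_mat N N" using A_carriers by auto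
  then have closed: "x + y \<in> V" "x - y \<in> V" "c \<cdot>\<^sub>m x \<in> V" if "x \<in> V" "y \<in> V" for x y c
    using that unfolding V_def by (auto intro: mat_lin.intros mat_lin_minus)
  have P: "P = 1\<^sub>m N + A1" and Q: "Q = P + A2" and R: "R = P + A3"
    and U: "U = Q + A3 + D + B2" and M: "M = 1\<^sub>m N + (1 / real k) \<cdot>\<^sub>m (A3 + D - B2)"
    subgoal by (rule eq_matI; auto simp: A_dims index_A index_kron)
    subgoal by (rule eq_matI; auto simp: A_dims index_A index_kron)
    subgoal by (rule eq_matI; auto simp: A_dims index_A index_kron)
    subgoal by (rule eq_matI; auto simp: A_dims index_A index_split index_kron D_def)
    subgoal
    proof (rule eq_matI)
      have "M = 1\<^sub>m N + (1 / real k) \<cdot>\<^sub>m B"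
        by (rule eq_matI) (use k_ge in \<open>auto simp: B_def\<close>)
      moreover fix x y
      assume "x < dim_row (1\<^sub>m N + (1 / real k) \<cdot>\<^sub>m (A3 + D - B2))"
        "y < dim_col (1\<^sub>m N + (1 / real k) \<cdot>\<^sub>m (A3 + D - B2))"
      then have "x < N" "y < N" by (auto simp: A_dims D_def)
      ultimately show "M $$ (x, y) = (1\<^sub>m N + (1 / real k) \<cdot>\<^sub>m (A3 + D - B2)) $$ (x, y)"
        unfolding split by (simp add: A_dims D_def)
    qed (auto simp: A_dims D_def)
    done
  have "P \<in> V"
    unfolding P using gens by (intro closed) auto
  moreover from this have Q': "Q \<in> V"
    unfolding Q using gens by (intro closed) auto
  moreover have "R \<in> V"
    unfolding R using gens \<open>P \<in> V\<close> by (intro closed) auto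
  moreover have "U \<in> V"
    unfolding U using gens Q' by (intro closed) auto
  moreover have "M \<in> V"
    unfolding M using gens by (intro closed) auto
  ultimately show ?thesis
    unfolding basis_def V_def[symmetric] using gens by blast
qed

text \<open>The product \<open>A i * A j\<close> is expanded in \<open>basis\<close>, whose span is
  closed under multiplication, and then re-expanded in the \<open>A i\<close>.\<close>

lemma A_scheme: "symmetric_association_scheme N 5 A"
proof -
  have "\<exists>c. A i * A j = matrix_sum N (\<lambda>l. c l \<cdot>\<^sub>m A l) {..5}" if "i \<le> 5" "j \<le> 5" for i j
  proof (rule mat_lin_coefficients)
    have "A i * A j \<in> mat_lin basis"
      using A_in_basis_span[OF that(1)] A_in_basis_span[OF that(2)] basis_carrier basis_mult
      by (rule mat_lin_mult)
    then show "A i * A j \<in> mat_lin (A ` {..5})"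
      using basis_in_A_span by (rule mat_lin_mono)
  qed (rule A_carriers)
  \<comment> \<open>The bounds move inside the existential quantifier, so that choice yields one
    function of \<open>i\<close> and \<open>j\<close>.\<close>
  then have "\<forall>i j. \<exists>c. i \<le> 5 \<longrightarrow> j \<le> 5 \<longrightarrow> A i * A j = matrix_sum N (\<lambda>l. c l \<cdot>\<^sub>m A l) {..5}"
    by blast
  then have "\<exists>p. \<forall>i\<le>5. \<forall>j\<le>5. A i * A j = matrix_sum N (\<lambda>l. p i j l \<cdot>\<^sub>m A l) {..5}"
    unfolding choice_iff by blast
  then show ?thesis
    unfolding symmetric_association_scheme_def
    using A_carriers A_nonzero A_zero_one A_symmetric A_sum A_list(1) by blast
qed

end

end

section \<open>Bush-type Hadamard matrices\<close>

lemma Hadamard_carrier: "Hadamard k H \<Longrightarrow> H \<in> carrier_mat k k"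
  by (simp add: Hadamard_def)

lemma Hadamard_index:
  "Hadamard k H \<Longrightarrow> r < k \<Longrightarrow> s < k \<Longrightarrow> H $$ (r, s) \<in> {-1, 1}"
  unfolding Hadamard_def using elements_matI by blast

lemma Hadamard_mult_transpose:
  assumes "Hadamard k H"
  shows "H * transpose_mat H = real k \<cdot>\<^sub>m 1\<^sub>m k"
proof (rule eq_matI)
  note H = Hadamard_carrier[OF assms]
  fix r s
  assume "r < dim_row (real k \<cdot>\<^sub>m 1\<^sub>m k)" "s < dim_col (real k \<cdot>\<^sub>m 1\<^sub>m k)"
  then have rs: "r < k" "s < k" by auto
  show "(H * transpose_mat H) $$ (r, s) = (real k \<cdot>\<^sub>m 1\<^sub>m k) $$ (r, s)"
  proof (cases "r = s")
    case True
    have "(H * transpose_mat H) $$ (r, s) = (\<Sum>l<k. H $$ (r, l) * transpose_mat H $$ (l, s))"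
      using H rs by (intro index_times_mat) auto
    also have "\<dots> = (\<Sum>l<k. 1)"
      using Hadamard_index[OF assms rs(1)] H rs True by (intro sum.cong) fastforce+
    finally show ?thesis using True rs by simp
  next
    case False
    then show ?thesis using assms H rs by (simp add: Hadamard_def)
  qed
qed (use Hadamard_carrier[OF assms] in auto)

text \<open>Multiplying a block by the all-ones matrix on the right or left produces its row or
  column sums, so the Bush condition prescribes them. The diagonal entry \<open>(a, a)\<close> of
  each product is enough to read off the sum with index \<open>a\<close>.\<close>

lemma Bush_type_block_sums:
  assumes "Bush_type n H" "i < 2 * n" "j < 2 * n" "a < 2 * n"
  shows "(\<Sum>d<2 * n. H $$ (i * (2 * n) + a, j * (2 * n) + d)) = (if i = j then 2 * real n else 0)"
    and "(\<Sum>d<2 * n. H $$ (i * (2 * n) + d, j * (2 * n) + a)) = (if i = j then 2 * real n else 0)"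
proof -
  let ?k = "2 * n"
  let ?b = "block ?k H i j"
  have b: "?b \<in> carrier_mat ?k ?k" by (simp add: block_def)
  have row: "(?b * all_ones ?k) $$ (a, a) = (\<Sum>d<?k. H $$ (i * ?k + a, j * ?k + d))"
    using assms(4) by (subst index_times_mat[OF b all_ones_carrier]) (auto simp: block_def)
  have col: "(all_ones ?k * ?b) $$ (a, a) = (\<Sum>d<?k. H $$ (i * ?k + d, j * ?k + a))"
    using assms(4) by (subst index_times_mat[OF all_ones_carrier b]) (auto simp: block_def)
  have eq: "?b * all_ones ?k = (if i = j then real ?k \<cdot>\<^sub>m all_ones ?k else 0\<^sub>m ?k ?k)"
    "all_ones ?k * ?b = (if i = j then real ?k \<cdot>\<^sub>m all_ones ?k else 0\<^sub>m ?k ?k)"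
    using assms unfolding Bush_type_def by (auto simp: all_ones_mult)
  show "(\<Sum>d<?k. H $$ (i * ?k + a, j * ?k + d)) = (if i = j then 2 * real n else 0)"
    using assms(4) unfolding row[symmetric] eq by (auto simp: all_ones_def)
  show "(\<Sum>d<?k. H $$ (i * ?k + d, j * ?k + a)) = (if i = j then 2 * real n else 0)"
    using assms(4) unfolding col[symmetric] eq by (auto simp: all_ones_def)
qed

text \<open>Each entry of \<open>H * T\<close> is the sum of a row of one block of \<open>H\<close>,
  and with the transpose it is the sum of a column. These sums are 2n on diagonal blocks and 0
  elsewhere, as in the scaled \<open>T\<close>.\<close>

lemma Bush_type_fix:
  assumes H: "Bush_type n H"
  defines "T \<equiv> 1\<^sub>m (2 * n) \<otimes>\<^sub>K all_ones (2 * n)"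
  shows "H * T = (2 * real n) \<cdot>\<^sub>m T" and "transpose_mat H * T = (2 * real n) \<cdot>\<^sub>m T"
proof -
  let ?k = "2 * n"
  have sq: "4 * n\<^sup>2 = ?k * ?k" by (simp add: power2_eq_square)
  have "H \<in> carrier_mat (?k * ?k) (?k * ?k)"
    using H unfolding Bush_type_def sq by (auto intro: Hadamard_carrier)
  moreover have "T \<in> carrier_mat (?k * ?k) (?k * ?k)"
    unfolding T_def by (rule kronecker_carrier) auto
  ultimately have carr: "H \<in> carrier_mat (?k * ?k) (?k * ?k)" "T \<in> carrier_mat (?k * ?k) (?k * ?k)" .
  have entries: "(H * T) $$ (r, s) = ((2 * real n) \<cdot>\<^sub>m T) $$ (r, s)"
    "(transpose_mat H * T) $$ (r, s) = ((2 * real n) \<cdot>\<^sub>m T) $$ (r, s)"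
    if rs: "r < ?k * ?k" "s < ?k * ?k" for r s
  proof -
    note r = div_mod_less[OF rs(1)] and s = div_mod_less[OF rs(2)]
    have r_eq: "r = r div ?k * ?k + r mod ?k" by (rule div_mult_mod_eq[symmetric])
    have T: "T $$ (r, s) = (if r div ?k = s div ?k then 1 else 0)"
      unfolding T_def index_kronecker[OF one_carrier_mat all_ones_carrier rs] using r s by simp
    have in_block: "s div ?k * ?k + d < ?k * ?k" if "d < ?k" for d
    proof -
      have "s div ?k * ?k + d < Suc (s div ?k) * ?k" using that by simp
      also have "\<dots> \<le> ?k * ?k" using s(1) by (intro mult_right_mono) auto
      finally show ?thesis .
    qed
    have "(H * T) $$ (r, s) = (\<Sum>d<?k. H $$ (r, s div ?k * ?k + d))"
      unfolding T_def using carr(1) rs by (rule index_times_block_all_ones)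
    also have "\<dots> = (if r div ?k = s div ?k then 2 * real n else 0)"
      by (subst r_eq) (rule Bush_type_block_sums(1)[OF H r(1) s(1) r(2)])
    finally show "(H * T) $$ (r, s) = ((2 * real n) \<cdot>\<^sub>m T) $$ (r, s)"
      using T carr(2) rs by simp
    have "(transpose_mat H * T) $$ (r, s) = (\<Sum>d<?k. transpose_mat H $$ (r, s div ?k * ?k + d))"
      unfolding T_def by (rule index_times_block_all_ones) (use carr(1) rs in auto)
    also have "\<dots> = (\<Sum>d<?k. H $$ (s div ?k * ?k + d, r))"
      using carr(1) rs(1) in_block by (intro sum.cong) auto
    also have "\<dots> = (if s div ?k = r div ?k then 2 * real n else 0)"
      by (subst r_eq) (rule Bush_type_block_sums(2)[OF H s(1) r(1) r(2)])
    finally show "(transpose_mat H * T) $$ (r, s) = ((2 * real n) \<cdot>\<^sub>m T) $$ (r, s)"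
      using T carr(2) rs by simp
  qed
  show "H * T = (2 * real n) \<cdot>\<^sub>m T" "transpose_mat H * T = (2 * real n) \<cdot>\<^sub>m T"
    by (rule eq_matI; use carr entries in simp)+
qed

text \<open>Scaling by 1/(2n) makes each H_i orthogonal and turns the factor 2n in
  \<open>Bush_type_fix\<close> into 1.\<close>

lemma Bush_type_unbiased_frames:
  fixes H :: "nat \<Rightarrow> real mat"
  assumes n: "n \<ge> 1" and m: "m \<ge> 1" and inj: "inj_on H {1..m}"
    and bush: "\<forall>i\<in>{1..m}. Bush_type n (H i)"
    and unb: "mutually_unbiased (4 * n\<^sup>2) (H ` {1..m})"
  shows "unbiased_frames m (2 * n)
    (\<lambda>i. if i = 0 then 1\<^sub>m (4 * n\<^sup>2) else (1 / (2 * real n)) \<cdot>\<^sub>m H i)"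
    (is "unbiased_frames m ?k ?F")
proof
  let ?T = "1\<^sub>m ?k \<otimes>\<^sub>K all_ones ?k"
  have sq: "4 * n\<^sup>2 = ?k * ?k" by (simp add: power2_eq_square)
  have T: "?T \<in> carrier_mat (?k * ?k) (?k * ?k)" by (rule kronecker_carrier) auto
  have had: "Hadamard (?k * ?k) (H i)" if "i \<in> {1..m}" for i
    using bush that unfolding Bush_type_def sq by blast
  note Hc = Hadamard_carrier[OF had]
  show "1 \<le> m" "2 \<le> ?k" using n m by auto
  fix i
  assume i: "i \<le> m"
  show Fi: "?F i \<in> carrier_mat (?k * ?k) (?k * ?k)"
    using i Hc[of i] unfolding sq by auto
  show "?F i * transpose_mat (?F i) = 1\<^sub>m (?k * ?k)"
  proof (cases "i = 0")
    case False
    then have i: "i \<in> {1..m}" using i by auto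
    have "?F i * transpose_mat (?F i)
        = (1 / (2 * real n) * (1 / (2 * real n))) \<cdot>\<^sub>m (H i * transpose_mat (H i))"
      using False Hc[OF i]
      by (simp add: transpose_smult mult_smult_distrib[of _ "?k * ?k" "?k * ?k" _ "?k * ?k"]
          mult_smult_assoc_mat[of _ "?k * ?k" "?k * ?k" _ "?k * ?k"] smult_smult_mat)
    also have "\<dots> = 1\<^sub>m (?k * ?k)"
      using n by (simp add: Hadamard_mult_transpose[OF had[OF i]] smult_smult_mat one_smult_mat)
    finally show ?thesis .
  qed (simp add: sq)
  have fix_rule: "c \<cdot>\<^sub>m X * ?T = ?T"
    if "X \<in> carrier_mat (?k * ?k) (?k * ?k)" "X * ?T = (2 * real n) \<cdot>\<^sub>m ?T" "c = 1 / (2 * real n)" for X c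
    using that n by (simp add: mult_smult_assoc_mat[OF that(1) T] smult_smult_mat one_smult_mat)
  show "?F i * ?T = ?T"
  proof (cases "i = 0")
    case False
    then have i: "i \<in> {1..m}" using i by auto
    show ?thesis using False fix_rule[OF Hc[OF i] Bush_type_fix(1)] bush i by simp
  qed (simp only: sq if_True simp_thms transpose_one left_mult_one_mat[OF T])
  show "transpose_mat (?F i) * ?T = ?T"
  proof (cases "i = 0")
    case False
    then have i: "i \<in> {1..m}" using i by auto
    have "transpose_mat (H i) \<in> carrier_mat (?k * ?k) (?k * ?k)" using Hc[OF i] by simp
    then show ?thesis
      using False fix_rule[OF _ Bush_type_fix(2)] bush i by (simp add: transpose_smult)
  qed (simp only: sq if_True simp_thms transpose_one left_mult_one_mat[OF T])
  fix j r s
  assume j: "j \<le> m" and ij: "i \<noteq> j" and rs: "r < ?k * ?k" "s < ?k * ?k"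
  consider "i = 0" "j \<in> {1..m}" | "j = 0" "i \<in> {1..m}" | "i \<in> {1..m}" "j \<in> {1..m}"
    using i j ij by force
  then show "real ?k * (?F i * transpose_mat (?F j)) $$ (r, s) \<in> {-1, 1}"
  proof cases
    case 1
    then have "?F i * transpose_mat (?F j) = (1 / (2 * real n)) \<cdot>\<^sub>m transpose_mat (H j)"
      using Hc[OF 1(2)] by (simp add: sq transpose_smult)
    then have "real ?k * (?F i * transpose_mat (?F j)) $$ (r, s) = H j $$ (s, r)"
      using Hc[OF 1(2)] rs n by simp
    then show ?thesis using Hadamard_index[OF had[OF 1(2)] rs(2,1)] by simp
  next
    case 2
    then have "?F i * transpose_mat (?F j) = (1 / (2 * real n)) \<cdot>\<^sub>m H i"
      using Hc[OF 2(2)] by (simp add: sq)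
    then have "real ?k * (?F i * transpose_mat (?F j)) $$ (r, s) = H i $$ (r, s)"
      using Hc[OF 2(2)] rs n by simp
    then show ?thesis using Hadamard_index[OF had[OF 2(2)] rs] by simp
  next
    case 3
    \<comment> \<open>Unbiasedness is given only for distinct members of the set, so injectivity is
      what carries it over to distinct indices.\<close>
    then have "H i \<noteq> H j" using inj_onD[OF inj _ 3] ij by blast
    moreover have "pairwise (unbiased (4 * n\<^sup>2)) (H ` {1..m})"
      using unb unfolding mutually_unbiased_def by (rule conjunct2)
    ultimately have "unbiased (4 * n\<^sup>2) (H i) (H j)"
      using 3 by (auto elim: pairwiseD)
    then obtain L where L: "Hadamard (?k * ?k) L"
      and HL: "H i * transpose_mat (H j) = sqrt (real (?k * ?k)) \<cdot>\<^sub>m L"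
      unfolding unbiased_def sq by blast
    have "?F i * transpose_mat (?F j)
        = (1 / (2 * real n) * (1 / (2 * real n))) \<cdot>\<^sub>m (H i * transpose_mat (H j))"
      using 3 Hc[OF 3(1)] Hc[OF 3(2)]
      by (simp add: transpose_smult mult_smult_distrib[of _ "?k * ?k" "?k * ?k" _ "?k * ?k"]
          mult_smult_assoc_mat[of _ "?k * ?k" "?k * ?k" _ "?k * ?k"] smult_smult_mat)
    \<comment> \<open>The square root of the order is 2n and cancels one of the two scaling
      factors.\<close>
    also have "\<dots> = (1 / (2 * real n)) \<cdot>\<^sub>m L"
      unfolding HL using n by (simp add: smult_smult_mat real_sqrt_mult)
    finally have "real ?k * (?F i * transpose_mat (?F j)) $$ (r, s) = L $$ (r, s)"
      using Hadamard_carrier[OF L] rs n by simp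
    then show ?thesis using Hadamard_index[OF L rs] by simp
  qed
qed

theorem theorem3p3:
  fixes n m N :: nat
    and H F :: "nat \<Rightarrow> real mat"
    and M B A0 A1 A2 A3 :: "real mat"
  assumes "n \<ge> 1" and "m \<ge> 2"
    and "inj_on H {1..m}"
    and "\<forall>i\<in>{1..m}. Bush_type n (H i)"
    and "mutually_unbiased (4 * n\<^sup>2) (H ` {1..m})"
    and "N = 4 * n\<^sup>2 * (m + 1)"
    and "F = (\<lambda>i. if i = 0 then 1\<^sub>m (4 * n\<^sup>2) else (1 / (2 * real n)) \<cdot>\<^sub>m H i)"
    and "M = block_column (m + 1) (4 * n\<^sup>2) F
             * block_row (m + 1) (4 * n\<^sup>2) (\<lambda>i. transpose_mat (F i))"
    and "B = (2 * real n) \<cdot>\<^sub>m (M - 1\<^sub>m N)"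
    and "A0 = 1\<^sub>m N"
    and "A1 = 1\<^sub>m (m + 1) \<otimes>\<^sub>K 1\<^sub>m (2 * n) \<otimes>\<^sub>K (all_ones (2 * n) - 1\<^sub>m (2 * n))"
    and "A2 = 1\<^sub>m (m + 1) \<otimes>\<^sub>K (all_ones (2 * n) - 1\<^sub>m (2 * n)) \<otimes>\<^sub>K all_ones (2 * n)"
    and "A3 = (all_ones (m + 1) - 1\<^sub>m (m + 1)) \<otimes>\<^sub>K 1\<^sub>m (2 * n) \<otimes>\<^sub>K all_ones (2 * n)"
  shows "B \<in> carrier_mat N N \<and> symmetric_matrix B \<and> elements_mat B \<subseteq> {0, 1, -1} \<and>
    (\<exists>B1 B2. B1 \<in> carrier_mat N N \<and> B2 \<in> carrier_mat N N \<and>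
       zero_one_matrix B1 \<and> zero_one_matrix B2 \<and> disjoint_matrices B1 B2 \<and> B = B1 - B2) \<and>
    (\<forall>B1 B2. B1 \<in> carrier_mat N N \<and> B2 \<in> carrier_mat N N \<and>
       zero_one_matrix B1 \<and> zero_one_matrix B2 \<and> disjoint_matrices B1 B2 \<and> B = B1 - B2 \<longrightarrow>
       symmetric_association_scheme N 5 (\<lambda>i. [A0, A1, A2, A3, B1 - A3, B2] ! i))"
proof -
  interpret unbiased_frames m "2 * n" F
    unfolding assms(7) by (rule Bush_type_unbiased_frames) (use assms(1-5) in auto)
  \<comment> \<open>The locale writes the order as \<open>k * k\<close> with
    \<open>k = 2 * n\<close>; with this rewriting the matrices of the theorem become those of the
    locale.\<close>
  have sq: "4 * n\<^sup>2 = 2 * n * (2 * n)" by (simp add: power2_eq_square)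
  have N: "N = unbiased_frames.N m (2 * n)"
    unfolding assms(6) N_def sq by simp
  have M: "M = unbiased_frames.M m (2 * n) F"
    unfolding assms(8) M_def sq ..
  have B: "B = unbiased_frames.B m (2 * n) F"
    unfolding assms(9) B_def M N by simp
  have A: "A1 = unbiased_frames.A1 m (2 * n)" "A2 = unbiased_frames.A2 m (2 * n)"
    "A3 = unbiased_frames.A3 m (2 * n)"
    unfolding assms(11-13) A1_def A2_def A3_def by (rule refl)+
  show ?thesis
    unfolding assms(10) A B N
    using B_carrier symmetric_B elements_B B_split_exists A_scheme by blast
qed

end
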